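(* Let $\mathbf f^{\mathrm P}:\Omega^{\mathrm P}\subseteq\mathbb R^{n_p}\to\mathbb R^{n_p}$ be the vector function of nonlinear pipe head-loss terms, with components $f^{\mathrm P}_i(\mathbf v)=R_i\,q_i|q_i|^{\mu-1}$ for $\mathbf v=(q_1,\dots,q_{n_p})\in\Omega^{\mathrm P}=[q_1^{\min},q_1^{\max}]\times\dots\times[q_{n_p}^{\min},q_{n_p}^{\max}]$, where $R_i>0$ for every $i$ and $\mu\ge 1$ are fixed (the bounds $q_i^{\min}$ may be negative). Then $\mathbf f^{\mathrm P}$ is Lipschitz continuous on $\Omega^{\mathrm P}$ with constant $$K^{\mathrm P}=\mu\,\max_{i} R_i\bigl(\max\{|q_i^{\min}|,|q_i^{\max}|\}\bigr)^{\mu-1}.$$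
   Context: A function $\mathbf f:\Omega\subseteq\mathbb R^n\to\mathbb R^m$ is Lipschitz continuous on $\Omega$ with constant $K\ge 0$ if $\|\mathbf f(\mathbf z_1)-\mathbf f(\mathbf z_2)\|_2\le K\|\mathbf z_1-\mathbf z_2\|_2$ for all $\mathbf z_1,\mathbf z_2\in\Omega$, where $\|\cdot\|_2$ is the Euclidean norm. In a water distribution network with $n_p\ge 1$ pipes, $q_i$ is the flow rate through pipe $i$, confined to the known compact interval $[q_i^{\min},q_i^{\max}]$, $R_i$ is its friction (resistance) coefficient, and $\mu$ is the constant flow exponent, the same for all pipes. For $\mu=1$, powers with exponent $\mu-1=0$ are read as $1$. *)

theory Defs
  imports "HOL-Analysis.Analysis"
begin

(* Real power with x^0 = 1 for every base, since powr has 0 powr 0 = 0.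
   It is only used with a base and an exponent that are nonnegative. *)
definition rpow :: "real \<Rightarrow> real \<Rightarrow> real" where
  "rpow x a = (if a = 0 then 1 else x powr a)"

definition head_loss :: "real ^ 'n \<Rightarrow> real \<Rightarrow> real ^ 'n \<Rightarrow> real ^ 'n" where
  "head_loss R \<mu> q = (\<chi> i. R $ i * (q $ i) * rpow \<bar>q $ i\<bar> (\<mu> - 1))"

definition head_loss_const ::
    "real ^ 'n \<Rightarrow> real \<Rightarrow> real ^ 'n \<Rightarrow> real ^ 'n \<Rightarrow> real" where
  "head_loss_const R \<mu> qmin qmax =
     \<mu> * (MAX i. R $ i * rpow (max \<bar>qmin $ i\<bar> \<bar>qmax $ i\<bar>) (\<mu> - 1))"

end

theory Submission
  imports Defs
begin

text \<open>
  The head-loss map acts on each coordinate separately, by \<open>x \<mapsto> R\<^sub>i x \<bar>x\<bar>\<^sup>a\<close> with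
  \<open>a = \<mu> - 1 \<ge> 0\<close>. Because \<open>a \<ge> 0\<close>, the odd power \<open>x \<bar>x\<bar>\<^sup>a\<close> is differentiable on the whole
  line, also where it changes sign, with derivative \<open>(a + 1) \<bar>x\<bar>\<^sup>a\<close>
  (\<open>DERIV_odd_power\<close>). On the symmetric interval of radius \<open>M\<close> this derivative is at most
  \<open>(a + 1) M\<^sup>a\<close>, so the mean value theorem gives a scalar Lipschitz bound
  (\<open>odd_power_lipschitz\<close>). The flow interval of a pipe lies in the symmetric interval whose
  radius is the larger modulus of its end points. Replacing the constants of the single pipes
  by their maximum gives \<open>\<bar>f\<^sub>i u - f\<^sub>i v\<bar> \<le> K \<bar>u\<^sub>i - v\<^sub>i\<bar>\<close> for all \<open>i\<close> with one \<open>K\<close>, and the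
  Euclidean norm is monotone in the moduli of the coordinates.
\<close>

lemma rpow_nonneg: "0 \<le> rpow x a"
  by (simp add: rpow_def)

lemma rpow_mono: "rpow x a \<le> rpow y a" if "0 \<le> a" "0 \<le> x" "x \<le> y"
  using that by (auto simp: rpow_def intro: powr_mono2)

text \<open>
  Away from the origin the function is \<open>\<plusminus>\<bar>x\<bar>\<^sup>a\<^sup>+\<^sup>1\<close>. At the origin its difference quotient is
  \<open>\<bar>h\<bar>\<^sup>a\<close>, which tends to \<open>0\<close> for \<open>a > 0\<close>. The case \<open>a = 0\<close> is the identity function, whose
  derivative at \<open>0\<close> agrees with the formula thanks to the convention \<open>0\<^sup>0 = 1\<close>.
\<close>

lemma DERIV_odd_power:
  assumes "0 \<le> a"
  shows "((\<lambda>x. x * rpow \<bar>x\<bar> a) has_real_derivative (a + 1) * rpow \<bar>x\<bar> a) (at x)"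
proof (cases "a = 0")
  case True
  then show ?thesis
    by (simp add: rpow_def)
next
  case False
  with assms have a: "0 < a" by simp
  have "((\<lambda>x. x * \<bar>x\<bar> powr a) has_real_derivative (a + 1) * \<bar>x\<bar> powr a) (at x)"
  proof (cases x "0::real" rule: linorder_cases)
    case greater
    have "((\<lambda>x. x * x powr a) has_real_derivative (a + 1) * \<bar>x\<bar> powr a) (at x)"
      using greater by (auto intro!: derivative_eq_intros simp: powr_diff field_simps)
    then show ?thesis
      by (rule has_field_derivative_transform_within_open[where S = "{0<..}"])
        (use greater in auto)
  next
    case less
    have "((\<lambda>x. x * (- x) powr a) has_real_derivative (a + 1) * \<bar>x\<bar> powr a) (at x)"
      using less by (auto intro!: derivative_eq_intros simp: powr_diff field_simps)
    then show ?thesis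
      by (rule has_field_derivative_transform_within_open[where S = "{..<0}"])
        (use less in auto)
  next
    case equal
    have "((\<lambda>h. \<bar>h\<bar> powr a) \<longlongrightarrow> \<bar>0::real\<bar> powr a) (at 0)"
      by (rule tendsto_powr') (use a in \<open>auto intro!: tendsto_eq_intros\<close>)
    then have "((\<lambda>h::real. h * \<bar>h\<bar> powr a / h) \<longlongrightarrow> 0) (at 0)"
      by (rule filterlim_cong[THEN iffD1, rotated -1])
        (auto simp: eventually_at_filter)
    with equal show ?thesis
      by (simp add: DERIV_def)
  qed
  with False show ?thesis
    by (simp add: rpow_def)
qed

lemma odd_power_lipschitz:
  assumes "0 \<le> a" "\<bar>x\<bar> \<le> M" "\<bar>y\<bar> \<le> M"
  shows "\<bar>x * rpow \<bar>x\<bar> a - y * rpow \<bar>y\<bar> a\<bar> \<le> (a + 1) * rpow M a * \<bar>x - y\<bar>"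
proof -
  have "norm (x * rpow \<bar>x\<bar> a - y * rpow \<bar>y\<bar> a) \<le> (a + 1) * rpow M a * norm (x - y)"
  proof (rule field_differentiable_bound[where S = "{- M..M}"])
    fix z assume "z \<in> {- M..M}"
    then have "rpow \<bar>z\<bar> a \<le> rpow M a"
      using assms(1) by (intro rpow_mono) auto
    then show "norm ((a + 1) * rpow \<bar>z\<bar> a) \<le> (a + 1) * rpow M a"
      using assms(1) by (simp add: abs_mult rpow_nonneg mult_left_mono)
  qed (use assms in \<open>auto intro: DERIV_subset[OF DERIV_odd_power]\<close>)
  then show ?thesis by simp
qed

theorem proposition1:
  fixes R qmin qmax :: "real ^ 'n" and \<mu> :: real
  assumes "\<And>i. R $ i > 0" and "\<mu> \<ge> 1"
  shows "(head_loss_const R \<mu> qmin qmax)-lipschitz_on (cbox qmin qmax) (head_loss R \<mu>)"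
proof -
  define M where "M i = max \<bar>qmin $ i\<bar> \<bar>qmax $ i\<bar>" for i
  define K where "K = head_loss_const R \<mu> qmin qmax"
  have pipe_le: "\<mu> * (R $ i * rpow (M i) (\<mu> - 1)) \<le> K" for i
    unfolding K_def head_loss_const_def M_def
    using assms(2) by (intro mult_left_mono Max_ge) auto
  have "0 \<le> \<mu> * (R $ i * rpow (M i) (\<mu> - 1))" for i
    using assms(1)[of i] assms(2) by (simp add: rpow_nonneg)
  from order_trans[OF this pipe_le] have "0 \<le> K" .
  have "norm (head_loss R \<mu> u - head_loss R \<mu> v) \<le> K * norm (u - v)"
    if u: "u \<in> cbox qmin qmax" and v: "v \<in> cbox qmin qmax" for u v
  proof -
    have "norm ((head_loss R \<mu> u - head_loss R \<mu> v) $ i) \<le> norm ((K *\<^sub>R (u - v)) $ i)" for i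
    proof -
      have bounds: "qmin $ i \<le> u $ i" "u $ i \<le> qmax $ i" "qmin $ i \<le> v $ i" "v $ i \<le> qmax $ i"
        using u v by (auto simp: mem_box_cart)
      have "\<bar>u $ i * rpow \<bar>u $ i\<bar> (\<mu> - 1) - v $ i * rpow \<bar>v $ i\<bar> (\<mu> - 1)\<bar>
          \<le> (\<mu> - 1 + 1) * rpow (M i) (\<mu> - 1) * \<bar>u $ i - v $ i\<bar>"
        by (rule odd_power_lipschitz) (use assms(2) bounds in \<open>auto simp: M_def\<close>)
      then have "R $ i * \<bar>u $ i * rpow \<bar>u $ i\<bar> (\<mu> - 1) - v $ i * rpow \<bar>v $ i\<bar> (\<mu> - 1)\<bar>
          \<le> R $ i * (\<mu> * rpow (M i) (\<mu> - 1) * \<bar>u $ i - v $ i\<bar>)"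
        using assms(1)[of i] by (intro mult_left_mono) auto
      also have "\<dots> = \<mu> * (R $ i * rpow (M i) (\<mu> - 1)) * \<bar>u $ i - v $ i\<bar>"
        by (simp add: mult_ac)
      also have "\<dots> \<le> K * \<bar>u $ i - v $ i\<bar>"
        by (intro mult_right_mono pipe_le) auto
      finally have "\<bar>R $ i * (u $ i * rpow \<bar>u $ i\<bar> (\<mu> - 1) - v $ i * rpow \<bar>v $ i\<bar> (\<mu> - 1))\<bar>
          \<le> K * \<bar>u $ i - v $ i\<bar>"
        using assms(1)[of i] by (simp add: abs_mult)
      then show ?thesis
        using \<open>0 \<le> K\<close> by (simp add: head_loss_def abs_mult mult.assoc flip: right_diff_distrib)
    qed
    then have "norm (head_loss R \<mu> u - head_loss R \<mu> v) \<le> norm (K *\<^sub>R (u - v))"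
      by (rule norm_le_componentwise_cart)
    with \<open>0 \<le> K\<close> show ?thesis by simp
  qed
  with \<open>0 \<le> K\<close> show ?thesis
    by (auto intro!: lipschitz_onI simp: dist_norm K_def)
qed

end
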